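(* Let $G^\sigma$ be an oriented graph of order $n\ge 4$ with maximum degree $\Delta$ and skew adjacency matrix $S$, and suppose $\det S\neq 0$. Write the eigenvalues of $S$ as $\mathrm{i}\lambda_1,\dots,\mathrm{i}\lambda_n$ with $\lambda_1\ge\lambda_2\ge\cdots\ge\lambda_n$ real. Then $$\mathcal{E}_s(G^\sigma)\geq 2\sqrt{\Delta}+(n-2)\left(\frac{\det S}{\Delta}\right)^{\frac{1}{n-2}},$$ with equality if and only if $\lambda_1=\sqrt{\Delta}$ and $\lambda_2=\lambda_3=\cdots=\lambda_{n/2}$.
   Context: An oriented graph $G^\sigma$ of a simple graph $G$ on vertices $v_1,\dots,v_n$ is obtained by giving each edge of $G$ one of its two directions. Its skew adjacency matrix $S=(s_{ij})$ has $s_{ij}=1$, $s_{ji}=-1$ if $\langle v_i,v_j\rangle$ is an arc, and $s_{ij}=s_{ji}=0$ otherwise; being real skew-symmetric, its eigenvalues are purely imaginary or zero. Maximum degree refers to the underlying graph $G$. The skew energy $\mathcal{E}_s(G^\sigma)$ is the sum of the moduli of all eigenvalues of $S$. (When $\det S\ne0$, $n$ is even and $\det S>0$.) *)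

theory Defs
  imports
    "Graph_Theory.Pair_Digraph"
    "Jordan_Normal_Form.Char_Poly"
    "HOL-Computational_Algebra.Fundamental_Theorem_Algebra"
begin

text \<open>A finite simple graph is a \<^locale>\<open>pair_graph\<close>: a finite, loop-free, symmetric
  set of arcs, so that every edge is represented by its two opposite arcs. An orientation keeps
  exactly one of the two.\<close>

definition is_orientation :: "'a pair_pre_digraph \<Rightarrow> 'a pair_pre_digraph \<Rightarrow> bool" where
  "is_orientation G H \<longleftrightarrow>
     pverts H = pverts G \<and> parcs H \<subseteq> parcs G \<and>
     (\<forall>u w. (u, w) \<in> parcs G \<longrightarrow> ((u, w) \<in> parcs H \<longleftrightarrow> (w, u) \<notin> parcs H))"

text \<open>In a symmetric digraph the out-degree of a vertex is its degree as an undirected graph.\<close>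

definition max_degree :: "'a pair_pre_digraph \<Rightarrow> nat" where
  "max_degree G = Max (out_degree (with_proj G) ` pverts G)"

text \<open>The vertices are listed as \<open>v 0, \<dots>, v (n - 1)\<close>, matching the index range of matrices.\<close>

definition skew_adjacency_matrix :: "(nat \<Rightarrow> 'a) \<Rightarrow> 'a pair_pre_digraph \<Rightarrow> real mat" where
  "skew_adjacency_matrix v H = mat (card (pverts H)) (card (pverts H))
     (\<lambda>(i, j). if (v i, v j) \<in> parcs H then 1 else if (v j, v i) \<in> parcs H then - 1 else 0)"

text \<open>All complex eigenvalues, with algebraic multiplicity.\<close>

definition spectrum_mset :: "real mat \<Rightarrow> complex multiset" where
  "spectrum_mset A = proots (char_poly (map_mat complex_of_real A))"

definition skew_energy :: "(nat \<Rightarrow> 'a) \<Rightarrow> 'a pair_pre_digraph \<Rightarrow> real" where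
  "skew_energy v H = (\<Sum>z\<in>#spectrum_mset (skew_adjacency_matrix v H). cmod z)"

text \<open>The eigenvalues are \<open>\<i> \<lambda>\<^sub>1, \<dots>, \<i> \<lambda>\<^sub>n\<close> with \<open>\<lambda>\<^sub>1 \<ge> \<dots> \<ge> \<lambda>\<^sub>n\<close> real.\<close>

definition imaginary_spectrum :: "nat \<Rightarrow> real mat \<Rightarrow> (nat \<Rightarrow> real) \<Rightarrow> bool" where
  "imaginary_spectrum n A lam \<longleftrightarrow>
     antimono_on {1..n} lam \<and>
     spectrum_mset A = image_mset (\<lambda>i. \<i> * complex_of_real (lam i)) (mset_set {1..n})"

text \<open>Such a listing always exists for a real skew-symmetric matrix, in particular for
  \<^term>\<open>skew_adjacency_matrix v H\<close>.\<close>

lemma skew_symmetric_eigenvalue_Re: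
  fixes A :: "real mat"
  assumes A: "A \<in> carrier_mat n n"
    and skew: "\<And>i j. i < n \<Longrightarrow> j < n \<Longrightarrow> A $$ (i, j) = - A $$ (j, i)"
    and ev: "eigenvalue (map_mat complex_of_real A) k"
  shows "Re k = 0"
proof -
  let ?B = "map_mat complex_of_real A"
  from ev A obtain x where x: "x \<in> carrier_vec n" "x \<noteq> 0\<^sub>v n" "?B *\<^sub>v x = k \<cdot>\<^sub>v x"
    unfolding eigenvalue_def eigenvector_def by auto
  have row: "(\<Sum>j<n. complex_of_real (A $$ (i, j)) * x $ j) = k * x $ i" if "i < n" for i
  proof -
    have "(?B *\<^sub>v x) $ i = (k \<cdot>\<^sub>v x) $ i" using x by simp
    then show ?thesis using that A x(1)
      by (simp add: scalar_prod_def lessThan_atLeast0)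
  qed
  define N where "N = (\<Sum>i<n. (cmod (x $ i))\<^sup>2)"
  define Q where "Q = (\<Sum>i<n. \<Sum>j<n. complex_of_real (A $$ (i, j)) * x $ j * cnj (x $ i))"
  have Q: "Q = k * complex_of_real N"
  proof -
    have "Q = (\<Sum>i<n. (\<Sum>j<n. complex_of_real (A $$ (i, j)) * x $ j) * cnj (x $ i))"
      by (simp add: Q_def sum_distrib_right)
    also have "\<dots> = (\<Sum>i<n. k * x $ i * cnj (x $ i))"
      by (intro sum.cong) (auto simp: row)
    also have "\<dots> = k * complex_of_real N"
      unfolding N_def of_real_sum sum_distrib_left mult.assoc complex_norm_square ..
    finally show ?thesis .
  qed
  have "cnj Q = (\<Sum>i<n. \<Sum>j<n. complex_of_real (A $$ (i, j)) * cnj (x $ j) * x $ i)"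
    by (simp add: Q_def)
  also have "\<dots> = (\<Sum>j<n. \<Sum>i<n. complex_of_real (A $$ (i, j)) * cnj (x $ j) * x $ i)"
    by (rule sum.swap)
  also have "\<dots> = (\<Sum>j<n. \<Sum>i<n. - (complex_of_real (A $$ (j, i)) * x $ i * cnj (x $ j)))"
  proof (intro sum.cong refl)
    fix j i assume "j \<in> {..<n}" "i \<in> {..<n}"
    then have "A $$ (i, j) = - A $$ (j, i)" by (intro skew) auto
    then show "complex_of_real (A $$ (i, j)) * cnj (x $ j) * x $ i =
        - (complex_of_real (A $$ (j, i)) * x $ i * cnj (x $ j))" by simp
  qed
  also have "\<dots> = - Q" by (simp add: Q_def sum_negf)
  finally have "Re (cnj Q) = Re (- Q)" by simp
  then have "Re k * N = 0" using Q by simp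
  moreover have "N \<noteq> 0"
  proof
    assume "N = 0"
    then have "x $ i = 0" if "i < n" for i
      using that by (auto simp: N_def sum_nonneg_eq_0_iff)
    then have "x = 0\<^sub>v n" using x(1) by (intro eq_vecI) auto
    with x(2) show False ..
  qed
  ultimately show ?thesis by simp
qed

lemma imaginary_spectrum_exists:
  fixes A :: "real mat"
  assumes A: "A \<in> carrier_mat n n"
    and skew: "\<And>i j. i < n \<Longrightarrow> j < n \<Longrightarrow> A $$ (i, j) = - A $$ (j, i)"
  shows "\<exists>lam. imaginary_spectrum n A lam"
proof -
  let ?B = "map_mat complex_of_real A"
  have B: "?B \<in> carrier_mat n n" using A by simp
  define xs where "xs = rev (sorted_list_of_multiset (image_mset Im (spectrum_mset A)))"
  have nz: "char_poly ?B \<noteq> 0"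
    using degree_monic_char_poly[OF B] by auto
  have mxs: "mset xs = image_mset Im (spectrum_mset A)" by (simp add: xs_def)
  have len: "length xs = n"
  proof -
    have "length xs = size (spectrum_mset A)" by (metis mxs size_mset size_image_mset)
    then show ?thesis
      using degree_monic_char_poly[OF B] by (simp add: spectrum_mset_def size_proots_complex)
  qed
  define lam where "lam i = xs ! (i - 1)" for i
  have xs_eq: "xs = map lam [1..<Suc n]"
    by (intro nth_equalityI) (auto simp: len lam_def simp del: upt_Suc)
  have "antimono_on {1..n} lam"
  proof (rule monotone_onI)
    fix i j :: nat assume ij: "i \<in> {1..n}" "j \<in> {1..n}" "i \<le> j"
    have "sorted (rev xs)" by (simp add: xs_def)
    then show "lam j \<le> lam i"
      unfolding lam_def using ij len by (intro sorted_rev_nth_mono) auto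
  qed
  moreover have "spectrum_mset A = image_mset (\<lambda>i. \<i> * complex_of_real (lam i)) (mset_set {1..n})"
  proof -
    have "mset_set {1..n} = mset [1..<Suc n]"
      by (simp only: mset_upt atLeastLessThanSuc_atLeastAtMost)
    then have "image_mset (\<lambda>i. \<i> * complex_of_real (lam i)) (mset_set {1..n}) =
        image_mset (\<lambda>y. \<i> * complex_of_real y) (mset xs)"
      unfolding xs_eq mset_map multiset.map_comp o_def by simp
    also have "\<dots> = image_mset (\<lambda>z. \<i> * complex_of_real (Im z)) (spectrum_mset A)"
      by (simp add: mxs multiset.map_comp o_def)
    also have "\<dots> = image_mset (\<lambda>z. z) (spectrum_mset A)"
    proof (rule image_mset_cong)
      fix z assume "z \<in># spectrum_mset A"
      then have "poly (char_poly ?B) z = 0"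
        using nz by (simp add: spectrum_mset_def)
      then have ev: "eigenvalue ?B z" using eigenvalue_root_char_poly[OF B] by simp
      have "Re z = 0" by (rule skew_symmetric_eigenvalue_Re[OF A skew ev])
      then show "\<i> * complex_of_real (Im z) = z" by (simp add: complex_eq_iff)
    qed
    finally show ?thesis by simp
  qed
  ultimately show ?thesis unfolding imaginary_spectrum_def by blast
qed

lemma skew_adjacency_matrix_skew:
  assumes "is_orientation G H" "i < card (pverts H)" "j < card (pverts H)"
  shows "skew_adjacency_matrix v H $$ (i, j) = - skew_adjacency_matrix v H $$ (j, i)"
  using assms unfolding is_orientation_def skew_adjacency_matrix_def by auto

end

theory Submission
  imports Defs "Jordan_Normal_Form.Schur_Decomposition"
begin

text \<open>Put \<open>m = n / 2\<close>, \<open>a = sqrt \<Delta>\<close> and \<open>c = (det S / \<Delta>) powr (1 / (n - 2))\<close>. The spectrum is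
  closed under conjugation, so that the energy is \<open>2 (\<lambda>\<^sub>1 + \<dots> + \<lambda>\<^sub>m)\<close> and
  \<open>det S = (\<lambda>\<^sub>1 \<cdots> \<lambda>\<^sub>m)\<^sup>2\<close>, whence \<open>\<lambda>\<^sub>1 \<cdots> \<lambda>\<^sub>m = a c ^ (m - 1)\<close>. A row of \<open>S\<close> has
  Euclidean norm at most \<open>\<lambda>\<^sub>1\<close>, which gives \<open>a \<le> \<lambda>\<^sub>1\<close>; the trace of \<open>S\<^sup>2\<close> and the
  arithmetic-geometric mean inequality give \<open>c \<le> a\<close>. Adding the tangent inequalities
  \<open>x \<ge> y + y ln (x / y)\<close> for \<open>(\<lambda>\<^sub>1, a)\<close> and for all \<open>(\<lambda>\<^sub>i, c)\<close>, \<open>i \<ge> 2\<close>, yields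
  \<open>\<lambda>\<^sub>1 + \<dots> + \<lambda>\<^sub>m \<ge> a + (m - 1) c\<close>, with equality only if \<open>\<lambda>\<^sub>1 = a\<close> and all \<open>\<lambda>\<^sub>i = c\<close>.\<close>

section \<open>Sums and products over \<open>{1..2 * m}\<close> folded about the midpoint\<close>

lemma sum_pairing:
  fixes f :: "nat \<Rightarrow> 'a::comm_monoid_add"
  shows "sum f {1..2 * m} = (\<Sum>i = 1..m. f i + f (2 * m + 1 - i))"
proof -
  have "sum f {1..2 * m} = sum f {1..m} + sum f {m + 1..2 * m}"
    by (subst sum.union_disjoint [symmetric]) (auto intro!: sum.cong)
  also have "sum f {m + 1..2 * m} = (\<Sum>i = 1..m. f (2 * m + 1 - i))"
    by (rule sum.reindex_bij_witness[of _ "\<lambda>i. 2 * m + 1 - i" "\<lambda>i. 2 * m + 1 - i"]) auto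
  finally show ?thesis by (simp add: sum.distrib)
qed

lemma prod_pairing:
  fixes f :: "nat \<Rightarrow> 'a::comm_monoid_mult"
  shows "prod f {1..2 * m} = (\<Prod>i = 1..m. f i * f (2 * m + 1 - i))"
proof -
  have "prod f {1..2 * m} = prod f {1..m} * prod f {m + 1..2 * m}"
    by (subst prod.union_disjoint [symmetric]) (auto intro!: prod.cong)
  also have "prod f {m + 1..2 * m} = (\<Prod>i = 1..m. f (2 * m + 1 - i))"
    by (rule prod.reindex_bij_witness[of _ "\<lambda>i. 2 * m + 1 - i" "\<lambda>i. 2 * m + 1 - i"]) auto
  finally show ?thesis by (simp add: prod.distrib)
qed

subsection \<open>Eigenvalues, traces of powers and determinants\<close>

lemma proots_prod_linear_factors:
  "proots (\<Prod>a\<leftarrow>as. [:- a, 1:]) = mset (as :: 'a::idom list)"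
proof (induction as)
  case (Cons a as)
  have "(\<Prod>a\<leftarrow>as. [:- a, 1:]) \<noteq> 0" by (auto simp: prod_list_zero_iff)
  then show ?case using Cons by (simp add: proots_mult del: mult_pCons_left)
qed simp

text \<open>Schur's theorem: similarity preserves the characteristic polynomial, and that of a
  triangular matrix splits along its diagonal. Traces and determinants can thus be read off from
  \<open>diag_mat B\<close>, with multiplicities.\<close>

lemma complex_triangularization:
  fixes A :: "complex mat"
  assumes A: "A \<in> carrier_mat n n"
  obtains B where "B \<in> carrier_mat n n" "upper_triangular B" "similar_mat A B"
    "proots (char_poly A) = mset (diag_mat B)"
proof -
  obtain es where "char_poly A = (\<Prod>a\<leftarrow>es. [:- a, 1:])"
    using char_poly_factorized[OF A] by blast
  from schur_decomposition_exists[OF A this] obtain B where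
    B: "B \<in> carrier_mat n n" "upper_triangular B" "similar_mat A B" by blast
  have "char_poly A = (\<Prod>a\<leftarrow>diag_mat B. [:- a, 1:])"
    using char_poly_similar[OF B(3)] char_poly_upper_triangular[OF B(1,2)] by simp
  then show thesis using B that by (simp only: proots_prod_linear_factors)
qed

lemma sum_diag_mult_commute:
  fixes A B :: "'a::comm_semiring_0 mat"
  assumes A: "A \<in> carrier_mat n n" and B: "B \<in> carrier_mat n n"
  shows "(\<Sum>i<n. (A * B) $$ (i, i)) = (\<Sum>i<n. (B * A) $$ (i, i))"
proof -
  have "(\<Sum>i<n. (A * B) $$ (i, i)) = (\<Sum>i<n. \<Sum>j<n. A $$ (i, j) * B $$ (j, i))"
    using A B by (simp add: scalar_prod_def lessThan_atLeast0)
  also have "\<dots> = (\<Sum>j<n. \<Sum>i<n. A $$ (i, j) * B $$ (j, i))"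
    by (rule sum.swap)
  also have "\<dots> = (\<Sum>i<n. (B * A) $$ (i, i))"
    using A B by (simp add: scalar_prod_def lessThan_atLeast0 mult.commute)
  finally show ?thesis .
qed

lemma upper_triangular_mult:
  fixes A B :: "'a::comm_semiring_0 mat"
  assumes A: "A \<in> carrier_mat n n" "upper_triangular A"
    and B: "B \<in> carrier_mat n n" "upper_triangular B"
  shows "upper_triangular (A * B)"
    and "i < n \<Longrightarrow> (A * B) $$ (i, i) = A $$ (i, i) * B $$ (i, i)"
proof -
  \<comment> \<open>Only indices with \<open>i \<le> k \<le> j\<close> contribute: none if
    \<open>j < i\<close>, and only \<open>k = i\<close> on the diagonal.\<close>
  have entry: "A $$ (i, k) * B $$ (k, j) = 0" if "i < n" "k < n" "k < i \<or> j < k" for i j k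
    using that upper_triangularD[OF A(2), of k i] upper_triangularD[OF B(2), of j k] A B by auto
  show "upper_triangular (A * B)"
  proof (rule upper_triangularI)
    fix i j assume "j < i" "i < dim_row (A * B)"
    then show "(A * B) $$ (i, j) = 0"
      using A B by (auto simp: scalar_prod_def intro!: sum.neutral entry)
  qed
  assume i: "i < n"
  then have "(A * B) $$ (i, i) = (\<Sum>k<n. A $$ (i, k) * B $$ (k, i))"
    using A B by (simp add: scalar_prod_def lessThan_atLeast0)
  also have "\<dots> = (\<Sum>k<n. if k = i then A $$ (i, i) * B $$ (i, i) else 0)"
    using i entry[of i _ i] by (intro sum.cong refl) (metis lessThan_iff linorder_neqE_nat)
  finally show "(A * B) $$ (i, i) = A $$ (i, i) * B $$ (i, i)" using i by simp
qed

lemma upper_triangular_pow: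
  fixes B :: "'a::comm_semiring_1 mat"
  assumes B: "B \<in> carrier_mat n n" "upper_triangular B"
  shows "upper_triangular (B ^\<^sub>m k) \<and> (\<forall>i<n. (B ^\<^sub>m k) $$ (i, i) = (B $$ (i, i)) ^ k)"
proof (induction k)
  case (Suc k)
  then show ?case
    using upper_triangular_mult[of "B ^\<^sub>m k" n B] B by (simp add: mult.commute)
qed (use B in simp)

text \<open>Write \<open>A ^\<^sub>m k\<close> as \<open>P * (B ^\<^sub>m k * Q)\<close> with
  \<open>B\<close> triangular. Invariance of the trace under swapping two factors moves
  \<open>P\<close> to the right, where it cancels against \<open>Q\<close>.\<close>

lemma sum_diag_pow:
  fixes A :: "complex mat"
  assumes A: "A \<in> carrier_mat n n"
  shows "(\<Sum>i<n. (A ^\<^sub>m k) $$ (i, i)) = (\<Sum>z\<in>#proots (char_poly A). z ^ k)"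
proof -
  obtain B where B: "B \<in> carrier_mat n n" "upper_triangular B" "similar_mat A B"
    and roots: "proots (char_poly A) = mset (diag_mat B)"
    using complex_triangularization[OF A] by blast
  from B(3) obtain P Q where wit: "similar_mat_wit A B P Q"
    unfolding similar_mat_def by blast
  note PQ = similar_mat_witD2[OF A wit]
  have Bk: "B ^\<^sub>m k \<in> carrier_mat n n" using B by simp
  have "A ^\<^sub>m k = P * (B ^\<^sub>m k * Q)"
    using similar_mat_wit_pow_id[OF wit, of k] PQ Bk by (simp add: assoc_mult_mat[of _ n n _ n _ n])
  then have "(\<Sum>i<n. (A ^\<^sub>m k) $$ (i, i)) = (\<Sum>i<n. (B ^\<^sub>m k * Q * P) $$ (i, i))"
    using sum_diag_mult_commute[OF PQ(6) mult_carrier_mat[OF Bk PQ(7)]] by (simp only:)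
  also have "B ^\<^sub>m k * Q * P = B ^\<^sub>m k"
    using PQ Bk by (simp add: assoc_mult_mat[of _ n n _ n _ n])
  also have "(\<Sum>i<n. (B ^\<^sub>m k) $$ (i, i)) = (\<Sum>i<n. (B $$ (i, i)) ^ k)"
    using upper_triangular_pow[OF B(1,2)] by simp
  also have "\<dots> = (\<Sum>z\<in>#proots (char_poly A). z ^ k)"
    using B(1) unfolding roots diag_mat_def
    by (simp add: sum_mset_sum_list lessThan_atLeast0 interv_sum_list_conv_sum_set_nat
        comp_def flip: mset_map)
  finally show ?thesis .
qed

lemma det_eq_prod_proots:
  fixes A :: "complex mat"
  assumes A: "A \<in> carrier_mat n n"
  shows "Determinant.det A = prod_mset (proots (char_poly A))"
proof -
  obtain B where B: "B \<in> carrier_mat n n" "upper_triangular B" "similar_mat A B"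
    and roots: "proots (char_poly A) = mset (diag_mat B)"
    using complex_triangularization[OF A] by blast
  show ?thesis
    using det_similar[OF B(3)] det_upper_triangular[OF B(2,1)]
    by (simp add: roots prod_mset_prod_list)
qed

section \<open>Symmetry of the spectrum of a real matrix\<close>

text \<open>Conjugating coefficients fixes the real characteristic polynomial but conjugates the
  root of each linear factor, so multiplicities are respected too.\<close>

lemma spectrum_mset_cnj:
  assumes A: "A \<in> carrier_mat n n"
  shows "image_mset cnj (spectrum_mset A) = spectrum_mset A"
proof -
  let ?C = "map_mat complex_of_real A"
  let ?p = "char_poly ?C"
  interpret cnj: comm_ring_hom cnj by unfold_locales auto
  interpret cnj_poly: map_poly_comm_ring_hom cnj ..
  have C: "?C \<in> carrier_mat n n" using A by simp
  obtain es where es: "?p = (\<Prod>a\<leftarrow>es. [:- a, 1:])"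
    using char_poly_factorized[OF C] by blast
  have "map_mat cnj ?C = ?C" by (intro eq_matI) auto
  then have "?p = map_poly cnj ?p" using cnj.char_poly_hom[OF C] by simp
  also have "\<dots> = (\<Prod>a\<leftarrow>map cnj es. [:- a, 1:])"
    by (simp add: es cnj_poly.hom_prod_list comp_def)
  finally have "proots ?p = mset (map cnj es)" by (simp only: proots_prod_linear_factors)
  moreover have "proots ?p = mset es" by (simp only: es proots_prod_linear_factors)
  ultimately show ?thesis by (simp add: spectrum_mset_def)
qed

text \<open>Conjugation negates every \<open>lam i\<close>, so the values form a multiset invariant
  under negation. Reversing a decreasing list and negating its entries both give ascending lists;
  having the same multiset, the two agree entry by entry.\<close>

lemma imaginary_spectrum_symmetric:
  assumes A: "A \<in> carrier_mat n n" and spec: "imaginary_spectrum n A lam" and i: "i \<in> {1..n}"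
  shows "lam (n + 1 - i) = - lam i"
proof -
  have anti: "antimono_on {1..n} lam"
    and sp: "spectrum_mset A = image_mset (\<lambda>i. \<i> * complex_of_real (lam i)) (mset_set {1..n})"
    using spec unfolding imaginary_spectrum_def by auto
  have "image_mset lam (mset_set {1..n}) = image_mset Im (spectrum_mset A)"
    by (simp add: sp multiset.map_comp comp_def)
  also have "\<dots> = image_mset Im (image_mset cnj (spectrum_mset A))"
    by (simp only: spectrum_mset_cnj[OF A])
  also have "\<dots> = image_mset (\<lambda>i. - lam i) (mset_set {1..n})"
    by (simp add: sp multiset.map_comp comp_def)
  finally have neg: "image_mset (\<lambda>i. - lam i) (mset_set {1..n}) = image_mset lam (mset_set {1..n})" ..
  have "bij_betw (\<lambda>i. n + 1 - i) {1..n} {1..n}"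
    by (rule bij_betwI[where g = "\<lambda>i. n + 1 - i"]) auto
  then have "image_mset (\<lambda>i. n + 1 - i) (mset_set {1..n}) = mset_set {1..n}"
    by (simp add: image_mset_mset_set bij_betw_def)
  then have rev: "image_mset (\<lambda>i. lam (n + 1 - i)) (mset_set {1..n}) = image_mset lam (mset_set {1..n})"
    by (metis (mono_tags, lifting) comp_def image_mset_cong multiset.map_comp)
  define xs where "xs = map (\<lambda>i. lam (n + 1 - i)) [1..<Suc n]"
  define ys where "ys = map (\<lambda>i. - lam i) [1..<Suc n]"
  have upt: "mset [1..<Suc n] = mset_set {1..n}"
    by (simp only: mset_upt atLeastLessThanSuc_atLeastAtMost)
  have "mset xs = mset ys"
    unfolding xs_def ys_def mset_map upt neg rev ..
  moreover have "sorted xs" "sorted ys"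
    unfolding xs_def ys_def
    by (auto simp: sorted_iff_nth_mono simp del: upt_Suc intro!: monotone_onD[OF anti])
  ultimately have "xs = ys" by (metis properties_for_sort)
  then have "xs ! (i - 1) = ys ! (i - 1)" by simp
  moreover have "i - 1 < Suc n - 1" "1 + (i - 1) = i" using i by auto
  ultimately show ?thesis by (simp only: xs_def ys_def nth_map_upt)
qed


subsection \<open>Eigenvalues of a real skew-symmetric matrix\<close>

lemma imaginary_spectrum_sum_diag_pow:
  assumes A: "A \<in> carrier_mat n n" and spec: "imaginary_spectrum n A lam"
  shows "complex_of_real (\<Sum>i<n. (A ^\<^sub>m k) $$ (i, i)) = (\<Sum>i = 1..n. (\<i> * complex_of_real (lam i)) ^ k)"
proof -
  let ?C = "map_mat complex_of_real A"
  have "complex_of_real (\<Sum>i<n. (A ^\<^sub>m k) $$ (i, i)) = (\<Sum>i<n. map_mat complex_of_real (A ^\<^sub>m k) $$ (i, i))"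
    using A by simp
  also have "\<dots> = (\<Sum>i<n. (?C ^\<^sub>m k) $$ (i, i))"
    by (simp only: of_real_hom.mat_hom_pow[OF A])
  also have "\<dots> = (\<Sum>z\<in>#spectrum_mset A. z ^ k)"
    using A by (simp add: sum_diag_pow[of _ n] spectrum_mset_def)
  also have "\<dots> = (\<Sum>i = 1..n. (\<i> * complex_of_real (lam i)) ^ k)"
    using spec by (simp add: imaginary_spectrum_def multiset.map_comp comp_def sum_unfold_sum_mset)
  finally show ?thesis .
qed

lemma imaginary_spectrum_det:
  assumes A: "A \<in> carrier_mat n n" and spec: "imaginary_spectrum n A lam"
  shows "complex_of_real (Determinant.det A) = (\<Prod>i = 1..n. \<i> * complex_of_real (lam i))"
proof -
  have "complex_of_real (Determinant.det A) = Determinant.det (map_mat complex_of_real A)"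
    by simp
  also have "\<dots> = prod_mset (spectrum_mset A)"
    using A by (simp only: det_eq_prod_proots[of _ n] map_carrier_mat spectrum_mset_def)
  finally show ?thesis
    using spec by (simp add: imaginary_spectrum_def prod_unfold_prod_mset)
qed

lemma skew_square_diag:
  fixes A :: "real mat"
  assumes A: "A \<in> carrier_mat n n"
    and skew: "\<And>i j. i < n \<Longrightarrow> j < n \<Longrightarrow> A $$ (i, j) = - A $$ (j, i)" and i: "i < n"
  shows "(A * A) $$ (i, i) = - (\<Sum>j<n. (A $$ (i, j))\<^sup>2)"
proof -
  have "(A * A) $$ (i, i) = (\<Sum>j<n. A $$ (i, j) * A $$ (j, i))"
    using A i by (simp add: scalar_prod_def lessThan_atLeast0)
  also have "\<dots> = (\<Sum>j<n. - (A $$ (i, j))\<^sup>2)"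
    using i by (intro sum.cong refl) (subst (2) skew, auto simp: power2_eq_square)
  finally show ?thesis by (simp add: sum_negf)
qed

text \<open>Both sides are minus the trace of \<open>A ^\<^sub>m 2\<close>, computed once from the
  eigenvalues and once from the entries.\<close>

lemma skew_sum_squares:
  fixes A :: "real mat"
  assumes A: "A \<in> carrier_mat n n"
    and skew: "\<And>i j. i < n \<Longrightarrow> j < n \<Longrightarrow> A $$ (i, j) = - A $$ (j, i)"
    and spec: "imaginary_spectrum n A lam"
  shows "(\<Sum>i = 1..n. (lam i)\<^sup>2) = (\<Sum>i<n. \<Sum>j<n. (A $$ (i, j))\<^sup>2)"
proof -
  have "complex_of_real (\<Sum>i<n. (A ^\<^sub>m 2) $$ (i, i)) = complex_of_real (- (\<Sum>i = 1..n. (lam i)\<^sup>2))"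
    unfolding imaginary_spectrum_sum_diag_pow[OF A spec] by (simp add: power_mult_distrib sum_negf)
  then have "(\<Sum>i<n. (A ^\<^sub>m 2) $$ (i, i)) = - (\<Sum>i = 1..n. (lam i)\<^sup>2)"
    by (simp only: of_real_eq_iff)
  moreover have "(\<Sum>i<n. (A ^\<^sub>m 2) $$ (i, i)) = (\<Sum>i<n. - (\<Sum>j<n. (A $$ (i, j))\<^sup>2))"
    using A by (intro sum.cong refl, subst skew_square_diag[OF A skew, symmetric])
      (auto simp: numeral_2_eq_2)
  ultimately show ?thesis by (simp add: sum_negf)
qed

section \<open>Row norms bounded by the largest eigenvalue\<close>

lemma pow_mat_add:
  fixes A :: "'a::semiring_1 mat"
  assumes A: "A \<in> carrier_mat n n"
  shows "A ^\<^sub>m (k + l) = A ^\<^sub>m k * A ^\<^sub>m l"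
proof (induction l)
  case (Suc l)
  then show ?case using A by (simp add: assoc_mult_mat[of _ n n _ n _ n])
qed (use A in simp)

text \<open>The sign \<open>s\<close> treats both cases at once: \<open>s = - 1\<close> for the skew
  matrix \<open>A\<close> itself, \<open>s = 1\<close> for its repeated squares.\<close>

lemma symmetric_mult_self:
  fixes X :: "real mat"
  assumes X: "X \<in> carrier_mat n n" and s: "s * s = 1"
    and sym: "\<And>i j. i < n \<Longrightarrow> j < n \<Longrightarrow> X $$ (i, j) = s * X $$ (j, i)" and ij: "i < n" "j < n"
  shows "(X * X) $$ (i, j) = (X * X) $$ (j, i)"
proof -
  have entry: "(X * X) $$ (i, j) = (\<Sum>k<n. X $$ (i, k) * X $$ (k, j))" if "i < n" "j < n" for i j
    using X that by (simp add: scalar_prod_def lessThan_atLeast0)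
  have "X $$ (i, k) * X $$ (k, j) = X $$ (j, k) * X $$ (k, i)" if "k < n" for k
  proof -
    have "X $$ (i, k) * X $$ (k, j) = (s * X $$ (k, i)) * (s * X $$ (j, k))"
      using sym[OF ij(1) that] sym[OF that ij(2)] by (simp only:)
    also have "\<dots> = (s * s) * (X $$ (j, k) * X $$ (k, i))" by (simp add: mult_ac)
    finally show ?thesis by (simp add: s)
  qed
  then show ?thesis using ij by (simp add: entry)
qed

text \<open>If \<open>y < x\<close> with \<open>y\<close> positive, the powers of
  \<open>x / y\<close> are unbounded and eventually exceed \<open>c\<close>. This is what removes
  the factor \<open>n\<close> from a trace estimate.\<close>

lemma le_of_power_le_const_mult:
  fixes x y c :: real
  assumes "0 \<le> x" "0 \<le> y" and le: "\<And>q. x ^ (2 ^ Suc q) \<le> c * y ^ (2 ^ Suc q)"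
  shows "x \<le> y"
proof (rule ccontr)
  assume "\<not> x \<le> y"
  then have xy: "y < x" by simp
  show False
  proof (cases "y = 0")
    case True
    with le[of 0] xy show False by (simp add: power2_eq_square mult_le_0_iff)
  next
    case False
    then have y: "0 < y" using assms by simp
    then have r: "1 < x / y" using xy by simp
    obtain p where p: "c < (x / y) ^ p" using real_arch_pow[OF r] by blast
    \<comment> \<open>Only exponents of the form \<open>2 ^ Suc q\<close> are available; the
      instance \<open>q = p\<close> is already large enough.\<close>
    have "Suc p < 2 ^ Suc p" by (rule less_exp)
    then have "p \<le> 2 ^ Suc p" by linarith
    then have "(x / y) ^ p \<le> (x / y) ^ (2 ^ Suc p)" using r by (intro power_increasing) auto
    also have "\<dots> \<le> c" using le[of p] y by (simp add: power_divide divide_simps)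
    finally show False using p by simp
  qed
qed

text \<open>Repeated squaring: a diagonal entry of the square of a symmetric matrix is the squared
  norm of a row, hence at least the square of the old diagonal entry. The induction starts at the
  fourth power, because the diagonal of \<open>A * A\<close> carries a minus sign that one more
  squaring removes.\<close>

lemma skew_row_norm_power_le:
  fixes A :: "real mat"
  assumes A: "A \<in> carrier_mat n n"
    and skew: "\<And>i j. i < n \<Longrightarrow> j < n \<Longrightarrow> A $$ (i, j) = - A $$ (j, i)" and i: "i < n"
  shows "(\<Sum>j<n. (A $$ (i, j))\<^sup>2) ^ (2 ^ Suc q) \<le> (A ^\<^sub>m (2 ^ Suc (Suc q))) $$ (i, i)"
proof -
  define M where "M q = A ^\<^sub>m (2 ^ q)" for q
  have carr: "M q \<in> carrier_mat n n" for q using A by (simp add: M_def)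
  have M_Suc: "M (Suc q) = M q * M q" for q
    by (simp add: M_def mult_2 pow_mat_add[OF A])
  have M_0: "M 0 = A" using A by (simp add: M_def)
  have sym: "M (Suc q) $$ (i, j) = M (Suc q) $$ (j, i)" if "i < n" "j < n" for i j q
    using that
  proof (induction q arbitrary: i j)
    case 0
    have "A $$ (i, j) = - 1 * A $$ (j, i)" if "i < n" "j < n" for i j
      using skew[OF that] by simp
    from symmetric_mult_self[OF A _ this 0] show ?case
      unfolding M_Suc M_0 by simp
  next
    case (Suc q)
    have "M (Suc q) $$ (i, j) = 1 * M (Suc q) $$ (j, i)" if "i < n" "j < n" for i j
      using Suc.IH[OF that] by simp
    from symmetric_mult_self[OF carr _ this Suc.prems] show ?case
      unfolding M_Suc[of "Suc q"] by simp
  qed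
  have step: "(M (Suc q) $$ (i, i))\<^sup>2 \<le> M (Suc (Suc q)) $$ (i, i)" for q
  proof -
    have "(M (Suc q) $$ (i, i))\<^sup>2 \<le> (\<Sum>j<n. (M (Suc q) $$ (i, j))\<^sup>2)"
      by (rule member_le_sum[where f = "\<lambda>j. (M (Suc q) $$ (i, j))\<^sup>2"]) (use i in auto)
    also have "\<dots> = (\<Sum>j<n. M (Suc q) $$ (i, j) * M (Suc q) $$ (j, i))"
    proof (intro sum.cong refl)
      fix j assume "j \<in> {..<n}"
      then show "(M (Suc q) $$ (i, j))\<^sup>2 = M (Suc q) $$ (i, j) * M (Suc q) $$ (j, i)"
        using sym[OF i, of j q] by (simp add: power2_eq_square)
    qed
    also have "\<dots> = M (Suc (Suc q)) $$ (i, i)"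
      using carr[of "Suc q"] i unfolding M_Suc[of "Suc q"]
      by (simp add: scalar_prod_def lessThan_atLeast0)
    finally show ?thesis .
  qed
  have "(\<Sum>j<n. (A $$ (i, j))\<^sup>2) ^ (2 ^ Suc q) \<le> M (Suc (Suc q)) $$ (i, i)"
  proof (induction q)
    case 0
    then show ?case
      using step[of 0] skew_square_diag[OF A skew i] by (simp add: M_Suc[of 0] M_0)
  next
    case (Suc q)
    have "(\<Sum>j<n. (A $$ (i, j))\<^sup>2) ^ (2 ^ Suc (Suc q)) = ((\<Sum>j<n. (A $$ (i, j))\<^sup>2) ^ (2 ^ Suc q))\<^sup>2"
      by (simp add: power_mult [symmetric] mult.commute)
    also have "\<dots> \<le> (M (Suc (Suc q)) $$ (i, i))\<^sup>2"
      using Suc by (intro power_mono) (auto intro!: sum_nonneg)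
    also have "\<dots> \<le> M (Suc (Suc (Suc q))) $$ (i, i)" by (rule step)
    finally show ?case .
  qed
  then show ?thesis by (simp only: M_def)
qed

lemma imaginary_spectrum_abs_le:
  assumes A: "A \<in> carrier_mat n n" and spec: "imaginary_spectrum n A lam" and i: "i \<in> {1..n}"
  shows "\<bar>lam i\<bar> \<le> lam 1"
proof -
  have anti: "antimono_on {1..n} lam" using spec by (simp add: imaginary_spectrum_def)
  have "lam i \<le> lam 1" "lam (n + 1 - i) \<le> lam 1"
    using i by (auto intro!: monotone_onD[OF anti])
  then show ?thesis using imaginary_spectrum_symmetric[OF A spec i] by simp
qed

text \<open>Instead of a Rayleigh quotient, traces of \<open>A ^\<^sub>m (2 ^ q)\<close> are used: the trace
  is at most \<open>n\<close> times a power of the largest eigenvalue, and the factor \<open>n\<close> disappears as \<open>q\<close>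
  tends to infinity.\<close>

lemma skew_row_norm_le:
  fixes A :: "real mat"
  assumes A: "A \<in> carrier_mat n n"
    and skew: "\<And>i j. i < n \<Longrightarrow> j < n \<Longrightarrow> A $$ (i, j) = - A $$ (j, i)"
    and spec: "imaginary_spectrum n A lam" and i: "i < n"
  shows "(\<Sum>j<n. (A $$ (i, j))\<^sup>2) \<le> (lam 1)\<^sup>2"
proof (rule le_of_power_le_const_mult[where c = "real n"])
  fix q
  let ?M = "A ^\<^sub>m (2 ^ Suc (Suc q))"
  note grow = skew_row_norm_power_le[OF A skew]
  have nonneg: "0 \<le> ?M $$ (k, k)" if "k < n" for k
    by (rule order_trans[OF _ grow[OF _ _ that]]) (auto intro!: sum_nonneg zero_le_power)
  \<comment> \<open>The exponent is a multiple of 4, so the imaginary unit disappears.\<close>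
  have pow: "(\<i> * complex_of_real x) ^ (2 ^ Suc (Suc q)) = complex_of_real ((x\<^sup>2) ^ (2 ^ Suc q))" for x
  proof -
    have "(\<i> * complex_of_real x) ^ (2 ^ Suc (Suc q)) = ((\<i> * complex_of_real x)\<^sup>2) ^ (2 ^ Suc q)"
      by (simp add: power_mult [symmetric])
    also have "\<dots> = (- complex_of_real (x\<^sup>2)) ^ (2 ^ Suc q)" by (simp add: power_mult_distrib)
    finally show ?thesis by simp
  qed
  have "complex_of_real (\<Sum>k<n. ?M $$ (k, k)) = complex_of_real (\<Sum>k = 1..n. ((lam k)\<^sup>2) ^ (2 ^ Suc q))"
    by (subst imaginary_spectrum_sum_diag_pow[OF A spec]) (simp only: pow of_real_sum)
  then have trace: "(\<Sum>k<n. ?M $$ (k, k)) = (\<Sum>k = 1..n. ((lam k)\<^sup>2) ^ (2 ^ Suc q))"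
    by (simp only: of_real_eq_iff)
  have "(\<Sum>j<n. (A $$ (i, j))\<^sup>2) ^ (2 ^ Suc q) \<le> ?M $$ (i, i)"
    by (rule grow[OF _ _ i])
  also have "\<dots> \<le> (\<Sum>k<n. ?M $$ (k, k))"
    by (rule member_le_sum[where f = "\<lambda>k. ?M $$ (k, k)"]) (use i nonneg in auto)
  also have "\<dots> \<le> (\<Sum>k = 1..n. ((lam 1)\<^sup>2) ^ (2 ^ Suc q))"
    unfolding trace
  proof (rule sum_mono)
    fix k assume "k \<in> {1..n}"
    from imaginary_spectrum_abs_le[OF A spec this] have "(lam k)\<^sup>2 \<le> (lam 1)\<^sup>2"
      by (simp add: abs_le_square_iff [symmetric])
    then show "((lam k)\<^sup>2) ^ (2 ^ Suc q) \<le> ((lam 1)\<^sup>2) ^ (2 ^ Suc q)"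
      by (rule power_mono) simp
  qed
  finally show "(\<Sum>j<n. (A $$ (i, j))\<^sup>2) ^ (2 ^ Suc q) \<le> real n * ((lam 1)\<^sup>2) ^ (2 ^ Suc q)" by simp
qed (auto intro!: sum_nonneg)

section \<open>Reduction to the positive half of the spectrum\<close>

text \<open>A nonzero determinant excludes zero eigenvalues. Each \<open>lam i\<close> in the first
  half is at least its mirror value \<open>- lam i\<close>, hence positive, and every symmetric
  function folds onto this half.\<close>

lemma imaginary_spectrum_half:
  assumes A: "A \<in> carrier_mat n n" and spec: "imaginary_spectrum n A lam"
    and det: "Determinant.det A \<noteq> 0"
  shows "even n"
    and "i \<in> {1..n div 2} \<Longrightarrow> 0 < lam i"
    and "Determinant.det A = (\<Prod>i = 1..n div 2. (lam i)\<^sup>2)"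
    and "(\<Sum>z\<in>#spectrum_mset A. cmod z) = 2 * (\<Sum>i = 1..n div 2. lam i)"
    and "(\<Sum>i = 1..n. (lam i)\<^sup>2) = 2 * (\<Sum>i = 1..n div 2. (lam i)\<^sup>2)"
proof -
  note sym = imaginary_spectrum_symmetric[OF A spec]
  have anti: "antimono_on {1..n} lam" using spec by (simp add: imaginary_spectrum_def)
  have "(\<Prod>i = 1..n. \<i> * complex_of_real (lam i)) \<noteq> 0"
    unfolding imaginary_spectrum_det[OF A spec, symmetric] using det by simp
  then have nz: "lam i \<noteq> 0" if "i \<in> {1..n}" for i
    using that by (auto simp: prod_zero_iff simp del: prod.distrib)
  show even: "even n"
  proof (rule ccontr)
    assume "odd n"
    \<comment> \<open>The middle index would be its own mirror image, forcing a zero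
      eigenvalue.\<close>
    then obtain k where "n = 2 * k + 1" by (elim oddE)
    with sym[of "k + 1"] nz[of "k + 1"] show False by simp
  qed
  define m where "m = n div 2"
  have n: "n = 2 * m" using even by (simp add: m_def)
  have pos: "0 < lam i" if "i \<in> {1..m}" for i
  proof -
    have "lam (n + 1 - i) \<le> lam i" using that n by (intro monotone_onD[OF anti]) auto
    then show ?thesis using sym[of i] nz[of i] that n by auto
  qed
  then show "i \<in> {1..n div 2} \<Longrightarrow> 0 < lam i" by (simp add: m_def)
  have sym': "lam (2 * m + 1 - i) = - lam i" if "i \<in> {1..m}" for i
    using sym[of i] that n by simp
  have "complex_of_real (Determinant.det A)
      = (\<Prod>i = 1..m. \<i> * complex_of_real (lam i) * (\<i> * complex_of_real (lam (2 * m + 1 - i))))"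
    unfolding imaginary_spectrum_det[OF A spec] n by (rule prod_pairing)
  \<comment> \<open>The two imaginary units of a pair give -1, which cancels the sign of the
    mirrored eigenvalue.\<close>
  also have "\<dots> = (\<Prod>i = 1..m. complex_of_real ((lam i)\<^sup>2))"
    by (intro prod.cong refl) (simp only: sym', simp add: power2_eq_square mult_ac)
  also have "\<dots> = complex_of_real (\<Prod>i = 1..m. (lam i)\<^sup>2)" by simp
  finally show "Determinant.det A = (\<Prod>i = 1..n div 2. (lam i)\<^sup>2)"
    by (simp only: of_real_eq_iff m_def)
  have "(\<Sum>z\<in>#spectrum_mset A. cmod z) = (\<Sum>i = 1..2 * m. \<bar>lam i\<bar>)"
    using spec by (simp add: imaginary_spectrum_def multiset.map_comp comp_def sum_unfold_sum_mset
        norm_mult n)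
  also have "\<dots> = (\<Sum>i = 1..m. 2 * lam i)"
    unfolding sum_pairing by (intro sum.cong refl) (use pos in \<open>simp only: sym', force\<close>)
  finally show "(\<Sum>z\<in>#spectrum_mset A. cmod z) = 2 * (\<Sum>i = 1..n div 2. lam i)"
    by (simp add: m_def sum_distrib_left)
  have "(\<Sum>i = 1..n. (lam i)\<^sup>2) = (\<Sum>i = 1..m. 2 * (lam i)\<^sup>2)"
    unfolding n sum_pairing by (intro sum.cong refl) (simp only: sym', simp)
  then show "(\<Sum>i = 1..n. (lam i)\<^sup>2) = 2 * (\<Sum>i = 1..n div 2. (lam i)\<^sup>2)"
    by (simp add: m_def sum_distrib_left)
qed


subsection \<open>The tangent-line form of the arithmetic-geometric mean inequality\<close>

text \<open>This is \<open>ln t \<le> t - 1\<close> at \<open>t = x / y\<close>, scaled by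
  \<open>y\<close>; equality holds only at \<open>t = 1\<close>.\<close>

lemma ln_tangent:
  fixes x y :: real
  assumes "0 < x" "0 < y"
  shows "y * (ln x - ln y) \<le> x - y"
    and "y * (ln x - ln y) = x - y \<Longrightarrow> x = y"
proof -
  have ln: "ln x - ln y = ln (x / y)" using assms by (simp add: ln_div)
  have xy: "x - y = y * (x / y - 1)" using assms by (simp add: field_simps)
  show "y * (ln x - ln y) \<le> x - y"
    unfolding ln xy using assms by (intro mult_left_mono ln_le_minus_one) auto
  assume "y * (ln x - ln y) = x - y"
  then have "ln (x / y) = x / y - 1" unfolding ln xy using assms by simp
  then have "x / y = 1" using assms by (intro ln_eq_minus_one) auto
  then show "x = y" using assms by simp
qed

text \<open>The hypotheses \<open>c \<le> a \<le> x0\<close> allow the term \<open>ln (x0 / a)\<close> to be weighted by \<open>c\<close>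
  instead of \<open>a\<close>, so that all logarithms cancel by the product condition.\<close>

lemma sum_ge_of_prod_eq:
  fixes x :: "'i \<Rightarrow> real" and x0 a c :: real
  assumes J: "finite J" "\<And>j. j \<in> J \<Longrightarrow> 0 < x j"
    and c: "0 < c" "c \<le> a" and a: "a \<le> x0"
    and prod: "x0 * prod x J = a * c ^ card J"
  shows "a + real (card J) * c \<le> x0 + sum x J"
    and "x0 + sum x J = a + real (card J) * c \<longleftrightarrow> x0 = a \<and> (\<forall>j\<in>J. x j = c)"
proof -
  have a_pos: "0 < a" and x0: "0 < x0" using c a by auto
  have "ln x0 + (\<Sum>j\<in>J. ln (x j)) = ln (x0 * prod x J)"
    using J x0 by (simp add: ln_mult ln_prod prod_pos less_imp_neq[symmetric] prod_zero_iff)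
  also have "\<dots> = ln a + real (card J) * ln c"
    unfolding prod using a_pos c by (simp add: ln_mult ln_realpow)
  finally have logs: "(\<Sum>j\<in>J. ln (x j) - ln c) = - (ln x0 - ln a)"
    by (simp add: sum_subtractf)
  \<comment> \<open>The slack of the inequality splits into nonnegative parts: the tangent gaps
    \<open>d\<close> and \<open>e j\<close>, and the term \<open>f\<close> left over from replacing
    the weight \<open>a\<close> by \<open>c\<close>. Equality therefore makes every tangent gap
    vanish.\<close>
  define d where "d = x0 - a - a * (ln x0 - ln a)"
  define e where "e j = x j - c - c * (ln (x j) - ln c)" for j
  define f where "f = (a - c) * (ln x0 - ln a)"
  have "sum e J = sum x J - real (card J) * c - c * (\<Sum>j\<in>J. ln (x j) - ln c)"
    by (simp add: e_def sum_subtractf sum_distrib_left right_diff_distrib)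
  then have split: "x0 + sum x J - (a + real (card J) * c) = d + sum e J + f"
    unfolding logs d_def f_def by (simp add: algebra_simps)
  have d: "0 \<le> d" using ln_tangent(1)[OF x0 a_pos] by (simp add: d_def)
  have e: "0 \<le> e j" if "j \<in> J" for j
    using ln_tangent(1)[OF J(2)[OF that] c(1)] by (simp add: e_def)
  have f: "0 \<le> f" using a a_pos c by (simp add: f_def)
  have sum_e: "0 \<le> sum e J" using e by (rule sum_nonneg)
  from split d sum_e f show "a + real (card J) * c \<le> x0 + sum x J" by linarith
  show "x0 + sum x J = a + real (card J) * c \<longleftrightarrow> x0 = a \<and> (\<forall>j\<in>J. x j = c)"
  proof
    assume "x0 + sum x J = a + real (card J) * c"
    with split d sum_e f have "d = 0" "sum e J = 0" by linarith+
    then have "x0 = a" using ln_tangent(2)[OF x0 a_pos] by (simp add: d_def)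
    moreover have "x j = c" if j: "j \<in> J" for j
    proof -
      have "e j = 0" using \<open>sum e J = 0\<close> e J(1) j by (simp add: sum_nonneg_eq_0_iff)
      then show ?thesis using ln_tangent(2)[OF J(2)[OF j] c(1)] by (simp add: e_def)
    qed
    ultimately show "x0 = a \<and> (\<forall>j\<in>J. x j = c)" by blast
  qed simp
qed

text \<open>Multiplying \<open>u \<le> exp (u - 1)\<close> over all \<open>u = y j / t\<close> gives
  the arithmetic-geometric mean inequality: the bound on the sum makes the total exponent
  nonpositive. For infinite \<open>J\<close> all products are 1 by convention.\<close>

lemma prod_le_of_sum_le:
  fixes y :: "'i \<Rightarrow> real"
  assumes "\<And>j. j \<in> J \<Longrightarrow> 0 \<le> y j" "0 < t" "sum y J \<le> real (card J) * t"
  shows "prod y J \<le> t ^ card J"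
proof -
  have "(\<Prod>j\<in>J. y j / t) \<le> (\<Prod>j\<in>J. exp (y j / t - 1))"
  proof (rule prod_mono)
    fix j assume "j \<in> J"
    then show "0 \<le> y j / t \<and> y j / t \<le> exp (y j / t - 1)"
      using assms exp_ge_add_one_self[of "y j / t - 1"] by simp
  qed
  also have "\<dots> \<le> 1"
  proof (cases "finite J")
    case True
    have "(\<Sum>j\<in>J. y j / t - 1) \<le> 0"
      using assms by (simp add: sum_subtractf divide_le_eq flip: sum_divide_distrib)
    then show ?thesis by (simp add: True flip: exp_sum)
  qed simp
  finally show ?thesis using assms(2) by (simp add: prod_dividef divide_le_eq)
qed

subsection \<open>Skew adjacency matrices\<close>

text \<open>Squaring forgets the orientation: an entry squares to 1 exactly at the neighbours in
  \<open>G\<close>.\<close>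

lemma skew_adjacency_row_sum_squares:
  assumes G: "pair_graph G" and H: "is_orientation G H"
    and v: "bij_betw v {..<card (pverts G)} (pverts G)" and i: "i < card (pverts G)"
  shows "(\<Sum>j<card (pverts G). (skew_adjacency_matrix v H $$ (i, j))\<^sup>2)
    = real (out_degree (with_proj G) (v i))"
proof -
  interpret pair_graph G by (rule G)
  let ?n = "card (pverts G)"
  have n: "card (pverts H) = ?n" using H by (simp add: is_orientation_def)
  have arcs: "(u, w) \<in> parcs G \<longleftrightarrow> (u, w) \<in> parcs H \<or> (w, u) \<in> parcs H" for u w
    using H arcs_symmetric[of u w] arcs_symmetric[of w u] unfolding is_orientation_def by blast
  let ?J = "{j. j < ?n \<and> (v i, v j) \<in> parcs G}"
  have "(\<Sum>j<?n. (skew_adjacency_matrix v H $$ (i, j))\<^sup>2) = (\<Sum>j<?n. if (v i, v j) \<in> parcs G then 1 else 0)"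
    using i by (intro sum.cong refl) (auto simp: skew_adjacency_matrix_def n arcs)
  also have "\<dots> = real (card ?J)"
    by (simp add: sum.If_cases Int_def lessThan_def)
  also have "card ?J = card (out_arcs (with_proj G) (v i))"
  proof (rule bij_betw_same_card)
    show "bij_betw (\<lambda>j. (v i, v j)) ?J (out_arcs (with_proj G) (v i))"
      unfolding bij_betw_def
    proof (intro conjI equalityI subsetI)
      show "inj_on (\<lambda>j. (v i, v j)) ?J"
        using v by (auto simp: bij_betw_def inj_on_def)
      fix e assume "e \<in> out_arcs (with_proj G) (v i)"
      then obtain w where w: "e = (v i, w)" "(v i, w) \<in> parcs G" by (cases e) auto
      then have "w \<in> pverts G" using wellformed by force
      then obtain j where "j < ?n" "w = v j" using v by (auto simp: bij_betw_def)
      then show "e \<in> (\<lambda>j. (v i, v j)) ` ?J" using w by auto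
    qed auto
  qed
  finally show ?thesis by (simp add: out_degree_def)
qed

section \<open>The skew energy bound and its equality case\<close>

theorem theorem4p2:
  fixes G H :: "'a pair_pre_digraph"
    and v :: "nat \<Rightarrow> 'a"
    and n :: nat
    and S :: "real mat"
    and lam :: "nat \<Rightarrow> real"
    and \<Delta> :: real
  assumes "pair_graph G"
    and "is_orientation G H"
    and "card (pverts G) = n"
    and "n \<ge> 4"
    and "bij_betw v {..<n} (pverts G)"
    and "S = skew_adjacency_matrix v H"
    and "\<Delta> = real (max_degree G)"
    and "Determinant.det S \<noteq> 0"
    and "imaginary_spectrum n S lam"
  shows "skew_energy v H \<ge>
           2 * sqrt \<Delta> + real (n - 2) * (Determinant.det S / \<Delta>) powr (1 / real (n - 2)) \<and>
         (skew_energy v H =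
           2 * sqrt \<Delta> + real (n - 2) * (Determinant.det S / \<Delta>) powr (1 / real (n - 2))
          \<longleftrightarrow> lam 1 = sqrt \<Delta> \<and> (\<forall>i\<in>{2..n div 2}. lam i = lam 2))"
proof -
  note n = \<open>card (pverts G) = n\<close> and n4 = \<open>n \<ge> 4\<close> and spec = \<open>imaginary_spectrum n S lam\<close>
  have verts: "card (pverts H) = n" using assms(2) n by (simp add: is_orientation_def)
  have S: "S \<in> carrier_mat n n" by (simp add: assms(6) skew_adjacency_matrix_def verts)
  have skew: "S $$ (i, j) = - S $$ (j, i)" if "i < n" "j < n" for i j
    unfolding assms(6) by (rule skew_adjacency_matrix_skew[OF assms(2)]) (use that verts in auto)
  have row: "(\<Sum>j<n. (S $$ (i, j))\<^sup>2) = real (out_degree (with_proj G) (v i))" if "i < n" for i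
    using skew_adjacency_row_sum_squares[OF assms(1,2), of v i] assms(5,6) that n by simp
  have verts_image: "pverts G = v ` {..<n}" using assms(5) by (simp add: bij_betw_def)
  have row_le: "(\<Sum>j<n. (S $$ (i, j))\<^sup>2) \<le> \<Delta>" if "i < n" for i
    using that by (simp add: row assms(7) max_degree_def verts_image)
  note half = imaginary_spectrum_half[OF S spec assms(8)]
  define m where "m = n div 2"
  have nm: "n = 2 * m" using half(1) by (simp add: m_def)
  have m2: "2 \<le> m" using n4 nm by simp
  have pos: "0 < lam i" if "i \<in> {1..m}" for i using half(2) that by (simp add: m_def)
  \<comment> \<open>The maximum degree is attained, so \<open>\<Delta>\<close> is itself the squared
    norm of some row and the row bound applies to it.\<close>
  have "max_degree G \<in> out_degree (with_proj G) ` pverts G"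
    unfolding max_degree_def by (rule Max_in) (use verts_image n4 in \<open>auto simp: lessThan_empty_iff\<close>)
  then obtain k where "k < n" "\<Delta> = (\<Sum>j<n. (S $$ (k, j))\<^sup>2)"
    using row verts_image assms(7) by auto
  then have lam1_sq: "\<Delta> \<le> (lam 1)\<^sup>2" using skew_row_norm_le[OF S skew spec] by simp
  \<comment> \<open>The mean of the squares over the positive half is at most
    \<open>\<Delta>\<close>. This yields first that \<open>\<Delta>\<close> is positive, then
    \<open>D \<le> \<Delta> ^ m\<close>.\<close>
  have "2 * (\<Sum>i = 1..m. (lam i)\<^sup>2) = (\<Sum>i<n. \<Sum>j<n. (S $$ (i, j))\<^sup>2)"
    using skew_sum_squares[OF S skew spec] half(5) by (simp add: m_def)
  also have "\<dots> \<le> (\<Sum>i<n. \<Delta>)" using row_le by (intro sum_mono) auto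
  finally have sum_sq: "(\<Sum>i = 1..m. (lam i)\<^sup>2) \<le> real m * \<Delta>" by (simp add: nm)
  have "0 < (\<Sum>i = 1..m. (lam i)\<^sup>2)"
    using pos m2 by (intro sum_pos) (auto simp: less_imp_neq[symmetric])
  then have "0 < real m * \<Delta>" using sum_sq by (rule order_less_le_trans)
  then have \<Delta>: "0 < \<Delta>" by (simp add: zero_less_mult_iff)
  define D where "D = Determinant.det S"
  have D: "D = (\<Prod>i = 1..m. lam i)\<^sup>2" using half(3) by (simp add: D_def m_def prod_power_distrib)
  have prod_lam_pos: "0 < (\<Prod>i = 1..m. lam i)" using pos by (intro prod_pos) auto
  then have D_pos: "0 < D" unfolding D by (rule zero_less_power)
  have D_le: "D \<le> \<Delta> ^ m"
    using prod_le_of_sum_le[of "{1..m}" "\<lambda>i. (lam i)\<^sup>2" \<Delta>] \<Delta> sum_sq by (simp add: D prod_power_distrib)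
  define a where "a = sqrt \<Delta>"
  define c where "c = (D / \<Delta>) powr (1 / real (n - 2))"
  have a: "0 < a" "a\<^sup>2 = \<Delta>" using \<Delta> by (auto simp: a_def)
  have c: "0 < c" using D_pos \<Delta> by (simp add: c_def)
  have n2: "n - 2 = 2 * (m - 1)" using nm by simp
  \<comment> \<open>Since \<open>n - 2\<close> is twice \<open>m - 1\<close>, the real power in
    \<open>c\<close> becomes a square root after raising to \<open>m - 1\<close>.\<close>
  have c_pow: "(c ^ (m - 1))\<^sup>2 = D / \<Delta>"
  proof -
    have "(c ^ (m - 1))\<^sup>2 = c ^ (n - 2)"
      unfolding n2 by (simp add: mult.commute flip: power_mult)
    also have "\<dots> = c powr real (n - 2)" using c by (simp only: powr_realpow)
    also have "\<dots> = D / \<Delta>" using D_pos \<Delta> n4 by (simp add: c_def powr_powr)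
    finally show ?thesis .
  qed
  have c_le: "c \<le> a"
  proof -
    have "D / \<Delta> \<le> \<Delta> ^ (m - 1)"
      using D_le \<Delta> m2 power_minus_mult[of m \<Delta>] by (simp add: divide_le_eq)
    also have "\<dots> = (a ^ (m - 1))\<^sup>2"
      unfolding a(2)[symmetric] by (simp add: mult.commute flip: power_mult)
    finally have "(c ^ (m - 1))\<^sup>2 \<le> (a ^ (m - 1))\<^sup>2" by (simp only: c_pow)
    then have "c ^ (m - 1) \<le> a ^ (m - 1)" by (rule power2_le_imp_le) (use a in simp)
    then show ?thesis using power_mono_iff[of c a "m - 1"] a c m2 by simp
  qed
  have a_le: "a \<le> lam 1" unfolding a_def
    using lam1_sq pos[of 1] m2 by (intro real_le_lsqrt) auto
  have "{1..m} = insert 1 {2..m}" using m2 by auto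
  then have prod_split: "(\<Prod>i = 1..m. lam i) = lam 1 * prod lam {2..m}"
    and sum_split: "(\<Sum>i = 1..m. lam i) = lam 1 + sum lam {2..m}" by simp_all
  \<comment> \<open>Both squares equal \<open>D\<close>; positivity then gives the product condition
    of the tangent argument.\<close>
  have "(a * c ^ (m - 1))\<^sup>2 = (\<Prod>i = 1..m. lam i)\<^sup>2"
    unfolding power_mult_distrib c_pow a(2) D[symmetric] using \<Delta> by simp
  then have "a * c ^ (m - 1) = (\<Prod>i = 1..m. lam i)"
    by (rule power2_eq_imp_eq) (use a c prod_lam_pos in auto)
  moreover have card: "card {2..m} = m - 1" by simp
  ultimately have prod: "lam 1 * prod lam {2..m} = a * c ^ card {2..m}"
    by (simp only: prod_split)
  have J: "finite {2..m}" "\<And>j. j \<in> {2..m} \<Longrightarrow> 0 < lam j" using pos by auto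
  note ineq = sum_ge_of_prod_eq[OF J c c_le a_le prod]
  have energy: "skew_energy v H = 2 * (lam 1 + sum lam {2..m})"
    using half(4) unfolding skew_energy_def assms(6)[symmetric] m_def[symmetric] sum_split .
  have bound: "2 * sqrt \<Delta> + real (n - 2) * (Determinant.det S / \<Delta>) powr (1 / real (n - 2))
      = 2 * (a + real (card {2..m}) * c)"
    by (simp only: a_def c_def D_def card n2) simp
  \<comment> \<open>The tangent argument characterizes equality by the value \<open>c\<close>, the
    theorem only by constancy. Once \<open>lam 1 = a\<close>, the product condition forces the
    common value to be \<open>c\<close>.\<close>
  have eq: "(\<forall>j\<in>{2..m}. lam j = c) \<longleftrightarrow> (\<forall>i\<in>{2..m}. lam i = lam 2)" if "lam 1 = a"
  proof
    assume all: "\<forall>i\<in>{2..m}. lam i = lam 2"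
    then have "prod lam {2..m} = (\<Prod>i = 2..m. lam 2)" by (blast intro: prod.cong)
    also have "\<dots> = lam 2 ^ (m - 1)" by simp
    finally have "lam 2 ^ (m - 1) = c ^ (m - 1)" using prod that a unfolding card by simp
    then have "lam 2 = c" by (rule power_eq_imp_eq_base) (use pos[of 2] c m2 in auto)
    with all show "\<forall>j\<in>{2..m}. lam j = c" by metis
  qed (use m2 in simp)
  show ?thesis
    unfolding bound
    unfolding energy m_def[symmetric] a_def[symmetric]
  proof
    show "2 * (a + real (card {2..m}) * c) \<le> 2 * (lam 1 + sum lam {2..m})"
      using ineq(1) by simp
    have double: "2 * x = 2 * y \<longleftrightarrow> x = y" for x y :: real by simp
    show "2 * (lam 1 + sum lam {2..m}) = 2 * (a + real (card {2..m}) * c)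
        \<longleftrightarrow> lam 1 = a \<and> (\<forall>i\<in>{2..m}. lam i = lam 2)"
      unfolding double using ineq(2) eq by blast
  qed
qed

end
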